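(* Let $N\ge 2$ be an integer and let $P$ be a symmetric probability density on $\Lambda^N$. Then there is a sequence $(P_n)$ of symmetric probability densities on $\Lambda^N$ with $P_n>0$ a.e. such that $P_n\to P$ in $L^1(\Lambda^N;d^Nx)$ and such that every $P_n$ satisfies the following condition: for a.e. $x_N$ in some subset $B_n\subset\Lambda$ of positive $dx$ measure, there is a constant $\gamma_n(x_N)>0$ such that $$P_n(\cdot,x_N)\ge\gamma_n(x_N)P_{n,(N-1)}\quad\text{a.e. on }\Lambda^{N-1}.$$
   Context: $\Lambda$ is a set with a $\sigma$-finite complete measure $dx$, of strictly positive total measure. For $k\ge 1$, $d^kx$ is the completion of the product measure $dx^{\otimes k}$ on $\Lambda^k$; "a.e." on $\Lambda^k$ refers to $d^kx$. A probability density on $\Lambda^N$ is a function $P\in L^1(\Lambda^N;d^Nx)$ with $P\ge 0$ and $\int_{\Lambda^N}P\,d^Nx=1$. For a symmetric probability density $Q$ on $\Lambda^N$ with $N\ge2$, $Q_{(N-1)}$ denotes the probability density on $\Lambda^{N-1}$ obtained by integrating $Q$ with respect to any one of its variables; $P_{n,(N-1)}$ is this reduction for $Q=P_n$. *)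

theory Defs
  imports "HOL-Analysis.Analysis" "HOL-Combinatorics.Permutations"
begin

text \<open>
  Points of the \<open>k\<close>-fold power of \<open>space M\<close> are extensional functions on the index set
  \<open>{..<k}\<close>; the variables are numbered from \<open>0\<close> to \<open>k - 1\<close>.
\<close>

definition power_measure :: "'a measure \<Rightarrow> nat \<Rightarrow> (nat \<Rightarrow> 'a) measure" where
  "power_measure M k = completion (\<Pi>\<^sub>M i\<in>{..<k}. M)"

text \<open>
  Densities are representatives of elements of \<open>L\<^sup>1\<close>, so nonnegativity and
  symmetry are required almost everywhere.
\<close>

definition prob_density :: "'a measure \<Rightarrow> nat \<Rightarrow> ((nat \<Rightarrow> 'a) \<Rightarrow> real) \<Rightarrow> bool" where
  "prob_density M k P \<longleftrightarrow>
     integrable (power_measure M k) P \<and>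
     (AE x in power_measure M k. 0 \<le> P x) \<and>
     (\<integral>x. P x \<partial>power_measure M k) = 1"

definition symmetric_fun :: "'a measure \<Rightarrow> nat \<Rightarrow> ((nat \<Rightarrow> 'a) \<Rightarrow> real) \<Rightarrow> bool" where
  "symmetric_fun M k P \<longleftrightarrow>
     (\<forall>\<pi>. \<pi> permutes {..<k} \<longrightarrow> (AE x in power_measure M k. P (x \<circ> \<pi>) = P x))"

text \<open>
  For \<open>Q\<close> a function of \<open>k + 1\<close> variables and \<open>z\<close> a point of the \<open>k\<close>-fold power,
  \<open>z(k := y)\<close> is the point \<open>(z, y)\<close> of the \<open>(k + 1)\<close>-fold power.  The last variable is
  integrated out; if \<open>Q\<close> is symmetric, any other variable gives the same function
  almost everywhere.
\<close>

definition reduction :: "'a measure \<Rightarrow> nat \<Rightarrow> ((nat \<Rightarrow> 'a) \<Rightarrow> real) \<Rightarrow> (nat \<Rightarrow> 'a) \<Rightarrow> real" where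
  "reduction M k Q z = (\<integral>y. Q (z(k := y)) \<partial>M)"

text \<open>Here \<open>x\<close> plays the role of the last variable; \<open>\<gamma>\<close> may depend on it.\<close>

definition bounded_below_by_reduction ::
    "'a measure \<Rightarrow> nat \<Rightarrow> ((nat \<Rightarrow> 'a) \<Rightarrow> real) \<Rightarrow> bool" where
  "bounded_below_by_reduction M N Q \<longleftrightarrow>
     (\<exists>B\<in>sets M. 0 < emeasure M B \<and>
       (AE x in M. x \<in> B \<longrightarrow>
         (\<exists>\<gamma>>0. AE z in power_measure M (N - 1).
            Q (z(N - 1 := x)) \<ge> \<gamma> * reduction M (N - 1) Q z)))"

end

theory Submission
  imports Defs
begin

text \<open>
  Fix a strictly positive integrable function \<open>h\<close> on \<open>\<Lambda>\<close> and let \<open>\<Phi>\<close> be its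
  \<open>N\<close>-fold tensor power.  Clamping \<open>P\<close> between \<open>\<Phi> / (n + 1)\<close> and \<open>(n + 1) \<Phi>\<close> and
  normalising preserves symmetry and converges to \<open>P\<close> in \<open>L\<^sup>1\<close>.  Any density that is
  comparable to \<open>\<Phi>\<close> has a reduction bounded by a multiple of the \<open>(N - 1)\<close>-fold tensor
  power of \<open>h\<close>, that is, of \<open>\<Phi>(\<cdot>, x) / h x\<close>, so one may take \<open>B\<^sub>n = \<Lambda>\<close>.
\<close>

definition tensor_power :: "('a \<Rightarrow> real) \<Rightarrow> nat \<Rightarrow> (nat \<Rightarrow> 'a) \<Rightarrow> real" where
  "tensor_power h k x = (\<Prod>i<k. h (x i))"

text \<open>\<open>Suc n\<close> keeps the lower cutoff meaningful from n = 0 on, where both cutoffs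
  equal \<open>w\<close>. For \<open>w > 0\<close> the lower cutoff never exceeds the upper
  one.\<close>

definition clamp_between :: "real \<Rightarrow> real \<Rightarrow> nat \<Rightarrow> real" where
  "clamp_between p w n = min (max p (w / real (Suc n))) (real (Suc n) * w)"

lemma tensor_power_pos: "(\<And>y. 0 < h y) \<Longrightarrow> 0 < tensor_power h k x"
  by (simp add: tensor_power_def prod_pos)

lemma tensor_power_permute:
  assumes "\<pi> permutes {..<k}"
  shows "tensor_power h k (x \<circ> \<pi>) = tensor_power h k x"
  using prod.permute[OF assms, of "\<lambda>i. h (x i)"] by (simp add: tensor_power_def o_def)

lemma tensor_power_upd: "tensor_power h (Suc k) (z(k := y)) = tensor_power h k z * h y"
  by (simp add: tensor_power_def)

lemma
  assumes "sigma_finite_measure M" and "integrable M h"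
  shows integrable_tensor_power: "integrable (power_measure M k) (tensor_power h k)"
    and integral_tensor_power:
      "(\<integral>x. tensor_power h k x \<partial>power_measure M k) = (\<integral>y. h y \<partial>M) ^ k"
proof -
  interpret product_sigma_finite "\<lambda>_::nat. M"
    using assms(1) by (simp add: product_sigma_finite_def)
  have int: "integrable (\<Pi>\<^sub>M i\<in>{..<k}. M) (tensor_power h k)"
    unfolding tensor_power_def
    by (rule product_integrable_prod) (use assms(2) in auto)
  have "(\<integral>x. tensor_power h k x \<partial>(\<Pi>\<^sub>M i\<in>{..<k}. M)) = (\<integral>y. h y \<partial>M) ^ k"
    unfolding tensor_power_def
    using product_integral_prod[of "{..<k}" "\<lambda>_. h"] assms(2) by simp
  then show "integrable (power_measure M k) (tensor_power h k)"
    and "(\<integral>x. tensor_power h k x \<partial>power_measure M k) = (\<integral>y. h y \<partial>M) ^ k"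
    \<comment> \<open>Measurable for the uncompleted product, the tensor power keeps its integral
      under completion.\<close>
    using int by (simp_all add: power_measure_def integrable_completion integral_completion)
qed

lemma clamp_between_ge: "0 < w \<Longrightarrow> w / real (Suc n) \<le> clamp_between p w n"
proof -
  assume "0 < w"
  then have "w / real (Suc n) \<le> w" "w \<le> real (Suc n) * w"
    by (simp_all add: divide_simps algebra_simps)
  then show ?thesis by (simp add: clamp_between_def)
qed

lemma clamp_between_le: "clamp_between p w n \<le> real (Suc n) * w"
  by (simp add: clamp_between_def)

text \<open>The clamp is positive, and raising \<open>p\<close> to the lower cutoff costs at most
  \<open>w\<close>. The bound is free of \<open>n\<close>, so it serves both for integrability and
  for domination.\<close>

lemma abs_clamp_between_le:
  assumes "0 < w"
  shows "\<bar>clamp_between p w n\<bar> \<le> \<bar>p\<bar> + w"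
proof -
  have "0 < w / real (Suc n)" "w / real (Suc n) \<le> w"
    using assms by (simp_all add: divide_simps algebra_simps)
  then show ?thesis using clamp_between_ge[OF assms, of n p]
    unfolding clamp_between_def by linarith
qed

text \<open>The lower cutoff tends to 0, while the upper one eventually exceeds \<open>p\<close> and
  stops acting.\<close>

lemma clamp_between_tendsto:
  assumes "0 \<le> p" and "0 < w"
  shows "clamp_between p w \<longlonglongrightarrow> p"
proof (rule Lim_transform_eventually)
  have "(\<lambda>n. max p (w / real (Suc n))) \<longlonglongrightarrow> max p 0"
    by (intro tendsto_max tendsto_const LIMSEQ_Suc lim_const_over_n)
  then show "(\<lambda>n. max p (w / real (Suc n))) \<longlonglongrightarrow> p"
    using assms(1) by simp
  obtain m where m: "p / w < real m"
    using reals_Archimedean2 by blast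
  have "max p (w / real (Suc n)) = clamp_between p w n" if "m \<le> n" for n
  proof -
    have "p / w \<le> real (Suc n)" using m that by linarith
    then have "p \<le> real (Suc n) * w" using assms(2) by (simp add: divide_simps)
    moreover have "w / real (Suc n) \<le> w" "w \<le> real (Suc n) * w"
      using assms by (simp_all add: divide_simps algebra_simps)
    ultimately show ?thesis by (simp add: clamp_between_def)
  qed
  then show "\<forall>\<^sub>F n in sequentially. max p (w / real (Suc n)) = clamp_between p w n"
    by (rule eventually_sequentiallyI)
qed

lemma integrable_clamp_between:
  assumes "integrable L P" and "integrable L W" and "\<And>x. 0 < W x"
  shows "integrable L (\<lambda>x. clamp_between (P x) (W x) n)"
proof (rule Bochner_Integration.integrable_bound)
  show "integrable L (\<lambda>x. \<bar>P x\<bar> + W x)" using assms by simp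
  show "(\<lambda>x. clamp_between (P x) (W x) n) \<in> borel_measurable L"
    using assms unfolding clamp_between_def by measurable
  show "AE x in L. norm (clamp_between (P x) (W x) n) \<le> norm (\<bar>P x\<bar> + W x)"
    using order_trans[OF abs_clamp_between_le[OF assms(3)] abs_ge_self] by (intro AE_I2) simp
qed

lemma clamp_between_tendsto_L1:
  assumes P: "integrable L P" and W: "integrable L W" and "\<And>x. 0 < W x"
    and "AE x in L. 0 \<le> P x"
  shows "(\<lambda>n. \<integral>x. \<bar>clamp_between (P x) (W x) n - P x\<bar> \<partial>L) \<longlonglongrightarrow> 0"
proof -
  note int = integrable_clamp_between[OF P W assms(3)]
  have "(\<lambda>n. \<integral>x. \<bar>clamp_between (P x) (W x) n - P x\<bar> \<partial>L) \<longlonglongrightarrow> (\<integral>x. 0 \<partial>L)"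
  proof (rule integral_dominated_convergence)
    \<comment> \<open>The dominating function is the uniform bound on the clamp plus one more
      \<open>\<bar>P x\<bar>\<close> from the triangle inequality.\<close>
    show "integrable L (\<lambda>x. 2 * \<bar>P x\<bar> + W x)" using P W by simp
    show "(\<lambda>x. \<bar>clamp_between (P x) (W x) n - P x\<bar>) \<in> borel_measurable L" for n
      using int[of n] P by measurable
    show "AE x in L. (\<lambda>n. \<bar>clamp_between (P x) (W x) n - P x\<bar>) \<longlonglongrightarrow> 0"
      using assms(4)
    proof eventually_elim
      case (elim x)
      show ?case
        using clamp_between_tendsto[OF elim assms(3)]
        by (intro tendsto_rabs_zero) (simp add: LIM_zero_iff)
    qed
    show "AE x in L. norm \<bar>clamp_between (P x) (W x) n - P x\<bar> \<le> 2 * \<bar>P x\<bar> + W x" for n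
    proof (rule AE_I2)
      fix x
      show "norm \<bar>clamp_between (P x) (W x) n - P x\<bar> \<le> 2 * \<bar>P x\<bar> + W x"
        using abs_clamp_between_le[OF assms(3), of "P x" x n] by simp
    qed
  qed simp
  then show ?thesis by simp
qed

text \<open>With c the integral of \<open>f\<close>, split f / c - g into (1 / c - 1) f and f - g.
  The first term has norm \<bar>1 - c\<bar>, the difference of the two integrals, so it is again at
  most the distance of \<open>f\<close> and \<open>g\<close>.\<close>

lemma normalised_L1_dist_le:
  fixes f g :: "'b \<Rightarrow> real"
  assumes f: "integrable L f" and g: "integrable L g" and "\<And>x. 0 \<le> f x"
    and "0 < (\<integral>x. f x \<partial>L)" and "(\<integral>x. g x \<partial>L) = 1"
  shows "(\<integral>x. \<bar>f x / (\<integral>x. f x \<partial>L) - g x\<bar> \<partial>L) \<le> 2 * (\<integral>x. \<bar>f x - g x\<bar> \<partial>L)"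
proof -
  define c where "c = (\<integral>x. f x \<partial>L)"
  have c: "0 < c" using assms(4) by (simp add: c_def)
  have "(\<integral>x. \<bar>f x / c - g x\<bar> \<partial>L) \<le> (\<integral>x. \<bar>1 / c - 1\<bar> * f x + \<bar>f x - g x\<bar> \<partial>L)"
  proof (rule integral_mono)
    fix x
    have "\<bar>f x / c - g x\<bar> \<le> \<bar>(1 / c - 1) * f x\<bar> + \<bar>f x - g x\<bar>"
      by (simp add: algebra_simps)
    then show "\<bar>f x / c - g x\<bar> \<le> \<bar>1 / c - 1\<bar> * f x + \<bar>f x - g x\<bar>"
      using assms(3)[of x] by (simp add: abs_mult)
  qed (use f g in auto)
  also have "\<dots> = \<bar>1 / c - 1\<bar> * c + (\<integral>x. \<bar>f x - g x\<bar> \<partial>L)"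
    using f g by (simp add: c_def)
  also have "\<bar>1 / c - 1\<bar> * c = \<bar>(1 / c - 1) * c\<bar>"
    using c by (simp only: abs_mult abs_of_pos)
  also have "(1 / c - 1) * c = - (\<integral>x. f x - g x \<partial>L)"
    using c f g assms(5) by (simp add: algebra_simps c_def)
  also have "\<bar>- (\<integral>x. f x - g x \<partial>L)\<bar> \<le> (\<integral>x. \<bar>f x - g x\<bar> \<partial>L)"
    using integral_abs_bound[of L "\<lambda>x. f x - g x"] by simp
  finally show ?thesis by (simp add: c_def)
qed

text \<open>Integrating the upper bound over the last variable controls the reduction, and the lower
  bound controls the slice at x, both by the same tensor power in the other variables. Since the
  bounds hold at every point, no null sets have to be sliced.\<close>

lemma bounded_below_by_reduction_if_comparable:
  assumes h: "integrable M h" "\<And>y. 0 < h y" and M: "0 < emeasure M (space M)"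
    and ab: "0 < a" "0 < b" and N: "0 < N"
    and lower: "\<And>x. a * tensor_power h N x \<le> Q x"
    and upper: "\<And>x. Q x \<le> b * tensor_power h N x"
  shows "bounded_below_by_reduction M N Q"
proof -
  define k where "k = N - 1"
  have N': "N = Suc k" using N by (simp add: k_def)
  define I where "I = (\<integral>y. h y \<partial>M)"
  have I: "0 \<le> I" using h(2) by (simp add: I_def integral_nonneg less_imp_le)
  have red: "reduction M k Q z \<le> b * (tensor_power h k z * I)" for z
  proof -
    have pos: "0 < tensor_power h k z" using h(2) by (rule tensor_power_pos)
    have "reduction M k Q z \<le> (\<integral>y. b * (tensor_power h k z * h y) \<partial>M)"
      unfolding reduction_def
    \<comment> \<open>A slice of \<open>Q\<close> need not be integrable. Its integral is then 0 by
      convention, which the nonnegative upper bound still dominates.\<close>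
    proof (rule integral_mono')
      show "Q (z(k := y)) \<le> b * (tensor_power h k z * h y)" for y
        using upper[of "z(k := y)"] by (simp add: N' tensor_power_upd)
      show "0 \<le> b * (tensor_power h k z * h y)" for y
        using ab pos h(2)[of y] by simp
    qed (use h(1) in simp)
    then show ?thesis by (simp add: I_def)
  qed
  have "\<exists>\<gamma>>0. AE z in power_measure M k. \<gamma> * reduction M k Q z \<le> Q (z(k := x))" for x
  proof (intro exI conjI AE_I2)
    \<comment> \<open>This is the quotient of the slice's lower factor \<open>a * h x\<close> by the
      reduction's upper factor \<open>b * I\<close>, with \<open>I + 1\<close> for \<open>I\<close>
      so that the denominator is visibly positive.\<close>
    let ?\<gamma> = "a * h x / (b * (I + 1))"
    show "0 < ?\<gamma>" using ab h(2)[of x] I by simp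
    fix z
    have pos: "0 < tensor_power h k z" using h(2) by (rule tensor_power_pos)
    have "?\<gamma> * reduction M k Q z \<le> ?\<gamma> * (b * (tensor_power h k z * (I + 1)))"
    proof (rule mult_left_mono)
      show "reduction M k Q z \<le> b * (tensor_power h k z * (I + 1))"
        using red[of z] mult_pos_pos[OF ab(2) pos] by (simp add: distrib_left)
    qed (use \<open>0 < ?\<gamma>\<close> in simp)
    also have "\<dots> = a * (tensor_power h k z * h x)"
      using ab(2) add_nonneg_pos[OF I zero_less_one] by simp
    also have "\<dots> \<le> Q (z(k := x))"
      using lower[of "z(k := x)"] by (simp add: N' tensor_power_upd)
    finally show "?\<gamma> * reduction M k Q z \<le> Q (z(k := x))" .
  qed
  then show ?thesis
    unfolding bounded_below_by_reduction_def k_def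
    using M by (intro bexI[of _ "space M"]) auto
qed

theorem theorem14:
  fixes M :: "'a measure" and N :: nat and P :: "(nat \<Rightarrow> 'a) \<Rightarrow> real"
  assumes "sigma_finite_measure M" and "complete_measure M"
    and "0 < emeasure M (space M)"
    and "N \<ge> 2"
    and "prob_density M N P" and "symmetric_fun M N P"
  shows "\<exists>Pn :: nat \<Rightarrow> (nat \<Rightarrow> 'a) \<Rightarrow> real.
    (\<forall>n. prob_density M N (Pn n) \<and> symmetric_fun M N (Pn n) \<and>
         (AE x in power_measure M N. 0 < Pn n x)) \<and>
    (\<lambda>n. \<integral>x. \<bar>Pn n x - P x\<bar> \<partial>power_measure M N) \<longlonglongrightarrow> 0 \<and>
    (\<forall>n. bounded_below_by_reduction M N (Pn n))"
proof -
  let ?L = "power_measure M N"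
  \<comment> \<open>Sigma-finiteness supplies \<open>h\<close>. Its positivity at every point makes
    the later bounds pointwise.\<close>
  obtain h :: "'a \<Rightarrow> real" where h_meas: "h \<in> borel_measurable M"
    and h_pos: "\<And>y. 0 < h y" and h: "integrable M h"
    by (rule sigma_finite_measure.obtain_positive_integrable_function[OF assms(1)]) blast
  define \<Phi> where "\<Phi> = tensor_power h N"
  have \<Phi>_pos: "0 < \<Phi> x" for x
    unfolding \<Phi>_def using h_pos by (rule tensor_power_pos)
  have \<Phi>_int: "integrable ?L \<Phi>"
    unfolding \<Phi>_def using assms(1) h by (rule integrable_tensor_power)
  \<comment> \<open>A positive function with zero integral would make the whole space null, against
    the positive total measure.\<close>
  have "(\<integral>y. h y \<partial>M) \<noteq> 0"
  proof
    assume "(\<integral>y. h y \<partial>M) = 0"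
    then have "AE y in M. h y = 0"
      using integral_nonneg_eq_0_iff_AE[OF h] h_pos by (simp add: less_imp_le)
    then have "AE y in M. False"
      using h_pos by (auto simp: less_le elim!: eventually_mono)
    then have "emeasure M (space M) = 0"
      by (simp add: AE_iff_null null_sets_def)
    then show False using assms(3) by simp
  qed
  then have "0 < (\<integral>y. h y \<partial>M)"
    using h_pos by (simp add: integral_nonneg less_imp_le order_less_le)
  then have \<Phi>_integral: "0 < (\<integral>x. \<Phi> x \<partial>?L)"
    unfolding \<Phi>_def using assms(1) h by (simp add: integral_tensor_power)
  have P: "integrable ?L P" "AE x in ?L. 0 \<le> P x" "(\<integral>x. P x \<partial>?L) = 1"
    using assms(5) by (simp_all add: prob_density_def)

  define R where "R n x = clamp_between (P x) (\<Phi> x) n" for n x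
  define c where "c n = (\<integral>x. R n x \<partial>?L)" for n
  have R_int: "integrable ?L (R n)" for n
    unfolding R_def using P(1) \<Phi>_int \<Phi>_pos by (rule integrable_clamp_between)
  have R_ge: "\<Phi> x / real (Suc n) \<le> R n x" for n x
    unfolding R_def using \<Phi>_pos by (rule clamp_between_ge)
  have R_le: "R n x \<le> real (Suc n) * \<Phi> x" for n x
    unfolding R_def by (rule clamp_between_le)
  \<comment> \<open>This holds even on the null set where \<open>P\<close> may be negative, thanks
    to the lower cutoff.\<close>
  have R_pos: "0 < R n x" for n x
    by (rule less_le_trans[OF _ R_ge]) (simp add: \<Phi>_pos)
  have c_pos: "0 < c n" for n
  proof -
    have "0 < (\<integral>x. \<Phi> x / real (Suc n) \<partial>?L)"
      using \<Phi>_integral by simp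
    also have "\<dots> \<le> c n"
      unfolding c_def using \<Phi>_int R_int R_ge by (intro integral_mono) auto
    finally show ?thesis .
  qed

  have density: "prob_density M N (\<lambda>x. R n x / c n)" for n
    unfolding prob_density_def using R_int[of n] R_pos c_pos[of n]
    by (auto simp: less_imp_le c_def[symmetric])
  have symmetric: "symmetric_fun M N (\<lambda>x. R n x / c n)" for n
    unfolding symmetric_fun_def
  proof (intro allI impI)
    fix \<pi> assume \<pi>: "\<pi> permutes {..<N}"
    then have "AE x in ?L. P (x \<circ> \<pi>) = P x"
      using assms(6) by (simp add: symmetric_fun_def)
    then show "AE x in ?L. R n (x \<circ> \<pi>) / c n = R n x / c n"
      \<comment> \<open>Clamping is pointwise, and its cutoffs are exactly permutation invariant, so
        the only exceptional points are those of \<open>P\<close>.\<close>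
      by eventually_elim (simp add: R_def \<Phi>_def tensor_power_permute[OF \<pi>])
  qed
  \<comment> \<open>The factor 2 is the price of normalisation in
    \<open>normalised_L1_dist_le\<close>.\<close>
  have "(\<lambda>n. 2 * (\<integral>x. \<bar>R n x - P x\<bar> \<partial>?L)) \<longlonglongrightarrow> 0"
    unfolding R_def
    using clamp_between_tendsto_L1[OF P(1) \<Phi>_int \<Phi>_pos P(2)] by (rule tendsto_mult_right_zero)
  then have limit: "(\<lambda>n. \<integral>x. \<bar>R n x / c n - P x\<bar> \<partial>?L) \<longlonglongrightarrow> 0"
  proof (rule tendsto_sandwich[OF always_eventually always_eventually tendsto_const, rotated -1])
    show "\<forall>n. 0 \<le> (\<integral>x. \<bar>R n x / c n - P x\<bar> \<partial>?L)" by simp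
    show "\<forall>n. (\<integral>x. \<bar>R n x / c n - P x\<bar> \<partial>?L) \<le> 2 * (\<integral>x. \<bar>R n x - P x\<bar> \<partial>?L)"
      unfolding c_def
      using normalised_L1_dist_le[OF R_int P(1) _ _ P(3)] R_pos c_pos
      by (simp add: less_imp_le c_def)
  qed
  have bounded: "bounded_below_by_reduction M N (\<lambda>x. R n x / c n)" for n
  proof (rule bounded_below_by_reduction_if_comparable[OF h h_pos assms(3)])
    \<comment> \<open>The constants are the cutoff factors 1 / (n + 1) and n + 1, each divided by
      \<open>c n\<close>.\<close>
    show "0 < 1 / (real (Suc n) * c n)" "0 < real (Suc n) / c n" using c_pos by simp_all
    show "1 / (real (Suc n) * c n) * tensor_power h N x \<le> R n x / c n" for x
      using divide_right_mono[OF R_ge less_imp_le[OF c_pos]] by (simp add: \<Phi>_def)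
    show "R n x / c n \<le> real (Suc n) / c n * tensor_power h N x" for x
      using divide_right_mono[OF R_le less_imp_le[OF c_pos]] by (simp add: \<Phi>_def)
  qed (use assms(4) in simp)
  show ?thesis
    by (rule exI[of _ "\<lambda>n x. R n x / c n"])
      (simp add: density symmetric limit bounded R_pos c_pos)
qed

end
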